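(* Let $X$ be a normed space over $\mathbb{F}\in\{\mathbb{R},\mathbb{C}\}$ of dimension at least 2, and let $T,S\in\mathbb{B}(X)$. Then $T\perp_{vB}S$ holds if and only if for every $\lambda\in\mathbb{T}$ there exist $\{x_{\lambda,n}\}_{n=1}^\infty\subset S_X$ and $\{x^*_{\lambda,n}\}_{n=1}^\infty\subset S_{X^*}$ with $x^*_{\lambda,n}(x_{\lambda,n})=1$ for all $n\ge1$ such that both of the following limits exist and satisfy $$\lim_{n\to\infty}\big|x^*_{\lambda,n}(Tx_{\lambda,n})\big|=v(T),\qquad \lim_{n\to\infty}\mathrm{Re}\left[\lambda\,\overline{x^*_{\lambda,n}(Tx_{\lambda,n})}\,x^*_{\lambda,n}(Sx_{\lambda,n})\right]\ge0.$$
   Context: $\mathbb{B}(X)$ is the space of bounded linear operators $X\to X$; $S_X$ is the unit sphere of $X$ and $S_{X^*}$ that of its dual $X^*$; $\mathbb{T}=\{\lambda\in\mathbb{F}:|\lambda|=1\}$. For $x\in X$, $J(x)=\{x^*\in S_{X^*}: x^*(x)=\|x\|\}$. The numerical radius of $T\in\mathbb{B}(X)$ is $v(T)=\sup\{|x^*(Tx)|: x\in S_X,\ x^*\in J(x)\}$. $T$ is numerical radius Birkhoff orthogonal to $S$, written $T\perp_{vB}S$, if $v(T+\alpha S)\ge v(T)$ for all $\alpha\in\mathbb{F}$. *)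

theory Defs
  imports "HOL-Analysis.Analysis"
begin

(* The scalar fields, treated uniformly: up to isometric isomorphism the only types of this class
   are real and complex. Real parts and conjugates of scalars are formed after to_complex. *)
class real_or_complex = real_normed_field +
  fixes to_complex :: "'a \<Rightarrow> complex"
  assumes to_complex_add: "to_complex (a + b) = to_complex a + to_complex b"
    and to_complex_mult: "to_complex (a * b) = to_complex a * to_complex b"
    and to_complex_one: "to_complex 1 = 1"
    and to_complex_scaleR: "to_complex (r *\<^sub>R a) = r *\<^sub>R to_complex a"
    and norm_to_complex: "cmod (to_complex a) = norm a"
    and range_to_complex: "range to_complex = \<real> \<or> range to_complex = UNIV"

instantiation real :: real_or_complex
begin

definition to_complex_real :: "real \<Rightarrow> complex" where
  "to_complex_real = complex_of_real"

instance
  by standard (auto simp: to_complex_real_def Reals_def scaleR_conv_of_real)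

end

instantiation complex :: real_or_complex
begin

definition to_complex_complex :: "complex \<Rightarrow> complex" where
  "to_complex_complex = id"

instance
  by standard (auto simp: to_complex_complex_def)

end

(* A normed space over 'k. The type class real_normed_vector supplies the norm and the underlying
   real normed space; smul is the scalar multiplication by 'k, which extends scaleR. *)
locale normed_space_over = vector_space smul
  for smul :: "'k::real_or_complex \<Rightarrow> 'a::real_normed_vector \<Rightarrow> 'a" +
  assumes scale_of_real: "smul (of_real r) x = r *\<^sub>R x"
    and norm_scale: "norm (smul c x) = norm c * norm x"

(* Stated for Hamel bases because dim is 0 on infinite-dimensional spaces. *)
definition dimension_at_least ::
    "('k::field \<Rightarrow> 'a::ab_group_add \<Rightarrow> 'a) \<Rightarrow> nat \<Rightarrow> bool" where
  "dimension_at_least smul n \<longleftrightarrow>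
     (\<forall>B. \<not> module.dependent smul B \<and> module.span smul B = UNIV \<longrightarrow> infinite B \<or> n \<le> card B)"

(* bounded_linear alone only expresses boundedness and real linearity. *)
definition bounded_operators ::
    "('k::real_or_complex \<Rightarrow> 'a::real_normed_vector \<Rightarrow> 'a) \<Rightarrow> ('a \<Rightarrow> 'a) set" where
  "bounded_operators smul = {T. Vector_Spaces.linear smul smul T \<and> bounded_linear T}"

definition dual_space ::
    "('k::real_or_complex \<Rightarrow> 'a::real_normed_vector \<Rightarrow> 'a) \<Rightarrow> ('a \<Rightarrow> 'k) set" where
  "dual_space smul = {f. Vector_Spaces.linear smul (*) f \<and> bounded_linear f}"

definition dual_sphere ::
    "('k::real_or_complex \<Rightarrow> 'a::real_normed_vector \<Rightarrow> 'a) \<Rightarrow> ('a \<Rightarrow> 'k) set" where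
  "dual_sphere smul = {f \<in> dual_space smul. onorm f = 1}"

definition support_functionals ::
    "('k::real_or_complex \<Rightarrow> 'a::real_normed_vector \<Rightarrow> 'a) \<Rightarrow> 'a \<Rightarrow> ('a \<Rightarrow> 'k) set" where
  "support_functionals smul x = {f \<in> dual_sphere smul. f x = of_real (norm x)}"

definition numerical_radius ::
    "('k::real_or_complex \<Rightarrow> 'a::real_normed_vector \<Rightarrow> 'a) \<Rightarrow> ('a \<Rightarrow> 'a) \<Rightarrow> real" where
  "numerical_radius smul T =
     Sup {norm (f (T x)) | x f. x \<in> sphere 0 1 \<and> f \<in> support_functionals smul x}"

definition numerical_radius_orthogonal ::
    "('k::real_or_complex \<Rightarrow> 'a::real_normed_vector \<Rightarrow> 'a) \<Rightarrow> ('a \<Rightarrow> 'a) \<Rightarrow> ('a \<Rightarrow> 'a) \<Rightarrow> bool" where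
  "numerical_radius_orthogonal smul T S \<longleftrightarrow>
     (\<forall>\<alpha>. numerical_radius smul (\<lambda>x. T x + smul \<alpha> (S x)) \<ge> numerical_radius smul T)"

end

(* Write |f(Tx) + t l f(Sx)|^2 = |f(Tx)|^2 + 2 t Re(l conj(f(Tx)) f(Sx)) + t^2 |f(Sx)|^2. If the
   sequences exist for l, the limit inferior of the right-hand side is at least v(T)^2. Conversely,
   choose (x, f) with |f(Tx) + t l f(Sx)| > v(T) - t^2 for t = 1/n: the square of the left-hand
   side is at least v(T)^2 - O(t^2), and |f(Tx)| <= v(T), so the real part is at least -O(t).

   Such pairs exist because f norming some x exists (Hahn-Banach). A minimal sublinear functional
   is linear, and one below inf_{t >= 0} (|x + t x0| - t |x0|) norms x0. *)

theory Submission
  imports Defs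
begin

section \<open>Norming functionals\<close>

definition sublinear :: "('a::real_vector \<Rightarrow> real) \<Rightarrow> bool" where
  "sublinear p \<longleftrightarrow> (\<forall>x y. p (x + y) \<le> p x + p y) \<and> (\<forall>r>0. \<forall>x. p (r *\<^sub>R x) = r * p x)"

lemma sublinear_add: "sublinear p \<Longrightarrow> p (x + y) \<le> p x + p y"
  by (simp add: sublinear_def)

lemma sublinear_scaleR: "sublinear p \<Longrightarrow> r > 0 \<Longrightarrow> p (r *\<^sub>R x) = r * p x"
  by (simp add: sublinear_def)

lemma sublinear_zero:
  assumes "sublinear p"
  shows "p 0 = 0"
  using sublinear_scaleR[OF assms, of 2 0] by simp

lemma sublinear_scaleR_nonneg: "sublinear p \<Longrightarrow> r \<ge> 0 \<Longrightarrow> p (r *\<^sub>R x) = r * p x"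
  by (cases "r = 0") (simp_all add: sublinear_zero sublinear_scaleR)

lemma sublinear_minus:
  assumes "sublinear p"
  shows "- p (- x) \<le> p x"
  using sublinear_add[OF assms, of x "- x"] sublinear_zero[OF assms] by simp

lemma sublinear_norm: "sublinear norm"
  by (simp add: sublinear_def norm_triangle_ineq)

text \<open>A pointwise infimum of sublinear functionals can fail to be subadditive; what saves it
  is that some index \<open>k\<close>, which may depend on \<open>x\<close> and \<open>y\<close>,
  beats any two given ones. For \<open>tilt\<close> that index is the sum of the two; in a chain it
  is the smaller functional.\<close>

lemma sublinear_INF:
  assumes "I \<noteq> {}" and bdd: "\<And>x. bdd_below ((\<lambda>i. f i x) ` I)"
    and add: "\<And>i j x y. i \<in> I \<Longrightarrow> j \<in> I \<Longrightarrow> \<exists>k\<in>I. f k (x + y) \<le> f i x + f j y"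
    and scale: "\<And>i r x. i \<in> I \<Longrightarrow> r > 0 \<Longrightarrow> \<exists>k\<in>I. f k (r *\<^sub>R x) \<le> r * f i x"
  shows "sublinear (\<lambda>x. INF i\<in>I. f i x)"
proof -
  let ?q = "\<lambda>x. INF i\<in>I. f i x"
  have le: "?q x \<le> f i x" if "i \<in> I" for i x
    using bdd that by (rule cINF_lower)
  have add': "?q (x + y) \<le> ?q x + ?q y" for x y
  proof -
    have "?q (x + y) - f i x \<le> ?q y" if i: "i \<in> I" for i
    proof (rule cINF_greatest[OF \<open>I \<noteq> {}\<close>])
      fix j assume "j \<in> I"
      then obtain k where "k \<in> I" "f k (x + y) \<le> f i x + f j y"
        using add i by blast
      then show "?q (x + y) - f i x \<le> f j y"
        using le[of k "x + y"] by linarith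
    qed
    then have "?q (x + y) - ?q y \<le> ?q x"
      by (intro cINF_greatest[OF \<open>I \<noteq> {}\<close>]) (simp add: algebra_simps)
    then show ?thesis by simp
  qed
  have scale_le: "?q (r *\<^sub>R x) \<le> r * ?q x" if r: "r > 0" for r x
  proof -
    have "?q (r *\<^sub>R x) / r \<le> ?q x"
    proof (rule cINF_greatest[OF \<open>I \<noteq> {}\<close>])
      fix i assume "i \<in> I"
      then obtain k where "k \<in> I" "f k (r *\<^sub>R x) \<le> r * f i x"
        using scale r by blast
      then have "?q (r *\<^sub>R x) \<le> r * f i x"
        using le[of k "r *\<^sub>R x"] by linarith
      then show "?q (r *\<^sub>R x) / r \<le> f i x"
        using r by (simp add: field_simps)
    qed
    then show ?thesis using r by (simp add: field_simps)
  qed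
  \<comment> \<open>The reverse inequality is the one just proved, for the factor
    \<open>1 / r\<close> at the point \<open>r *\<^sub>R x\<close>.\<close>
  have "r * ?q x \<le> ?q (r *\<^sub>R x)" if r: "r > 0" for r x
    using scale_le[of "1 / r" "r *\<^sub>R x"] r by (simp add: field_simps)
  then show ?thesis
    unfolding sublinear_def using add' scale_le by (meson order_antisym)
qed

text \<open>For sublinear \<open>p\<close> this is the largest sublinear functional below
  \<open>p\<close> whose value at \<open>- y\<close> is at most \<open>- p y\<close>. A linear
  functional below it must therefore agree with \<open>p\<close> at \<open>y\<close>.\<close>

definition tilt :: "('a::real_vector \<Rightarrow> real) \<Rightarrow> 'a \<Rightarrow> 'a \<Rightarrow> real" where
  "tilt p y x = (INF t\<in>{0..}. p (x + t *\<^sub>R y) - t * p y)"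

lemma tilt_bdd_below:
  assumes "sublinear p"
  shows "bdd_below ((\<lambda>t. p (x + t *\<^sub>R y) - t * p y) ` {0..})"
proof (rule bdd_belowI2)
  fix t :: real assume "t \<in> {0..}"
  then have "t * p y \<le> p (x + t *\<^sub>R y) + p (- x)"
    using sublinear_add[OF assms, of "x + t *\<^sub>R y" "- x"]
    by (simp add: sublinear_scaleR_nonneg[OF assms])
  then show "- p (- x) \<le> p (x + t *\<^sub>R y) - t * p y" by simp
qed

lemma tilt_le:
  assumes "sublinear p" "t \<ge> 0"
  shows "tilt p y x \<le> p (x + t *\<^sub>R y) - t * p y"
  unfolding tilt_def using assms by (intro cINF_lower tilt_bdd_below) auto

lemma tilt_le_self: "sublinear p \<Longrightarrow> tilt p y x \<le> p x"
  using tilt_le[of p 0 y x] by simp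

lemma sublinear_tilt:
  assumes p: "sublinear p"
  shows "sublinear (tilt p y)"
  unfolding tilt_def
proof (rule sublinear_INF)
  fix s t :: real and x z assume "s \<in> {0..}" "t \<in> {0..}"
  then show "\<exists>k\<in>{0..}. p (x + z + k *\<^sub>R y) - k * p y
      \<le> p (x + s *\<^sub>R y) - s * p y + (p (z + t *\<^sub>R y) - t * p y)"
    using sublinear_add[OF p, of "x + s *\<^sub>R y" "z + t *\<^sub>R y"]
    by (intro bexI[of _ "s + t"]) (auto simp: algebra_simps)
next
  fix s r :: real and x assume "s \<in> {0..}" "r > 0"
  then show "\<exists>k\<in>{0..}. p (r *\<^sub>R x + k *\<^sub>R y) - k * p y \<le> r * (p (x + s *\<^sub>R y) - s * p y)"
    using sublinear_scaleR[OF p, of r "x + s *\<^sub>R y"]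
    by (intro bexI[of _ "r * s"]) (auto simp: algebra_simps)
qed (use tilt_bdd_below[OF p] in auto)

text \<open>Every \<open>tilt p y\<close> is sublinear and below \<open>p\<close>, so minimality
  makes it equal to \<open>p\<close>. Its term for \<open>t = 1\<close> then reads
  \<open>p x \<le> p (x + y) - p y\<close>, which is the converse of subadditivity.\<close>

lemma minimal_sublinear_linear:
  assumes p: "sublinear p"
    and minimal: "\<And>q. sublinear q \<Longrightarrow> (\<And>x. q x \<le> p x) \<Longrightarrow> q = p"
  shows "linear p"
proof -
  have tilt: "tilt p y = p" for y
    by (intro minimal sublinear_tilt p tilt_le_self)
  have add: "p (x + y) = p x + p y" for x y
    using tilt_le[OF p, of 1 y x] sublinear_add[OF p, of x y] by (simp add: tilt)
  have minus: "p (- x) = - p x" for x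
    using add[of x "- x"] sublinear_zero[OF p] by simp
  have "p (r *\<^sub>R x) = r * p x" for r x
  proof (cases "r \<ge> 0")
    case True
    then show ?thesis by (rule sublinear_scaleR_nonneg[OF p])
  next
    case False
    then show ?thesis
      using sublinear_scaleR_nonneg[OF p, of "- r" x] minus[of "r *\<^sub>R x"] by simp
  qed
  with add show ?thesis by (intro linearI) simp_all
qed

text \<open>Zorn's lemma with pointwise infima as bounds of chains. They are finite because a
  sublinear \<open>f\<close> below \<open>p\<close> satisfies
  \<open>f x \<ge> - f (- x) \<ge> - p (- x)\<close>.\<close>

lemma ex_minimal_sublinear:
  fixes p :: "'a::real_vector \<Rightarrow> real"
  assumes p: "sublinear p"
  shows "\<exists>m. sublinear m \<and> (\<forall>x. m x \<le> p x)
    \<and> (\<forall>q. sublinear q \<longrightarrow> (\<forall>x. q x \<le> m x) \<longrightarrow> q = m)"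
proof -
  define A where "A = {q. sublinear q \<and> (\<forall>x. q x \<le> p x)}"
  \<comment> \<open>The order is reversed: Zorn's lemma yields maximal elements, and minimal ones
    are wanted.\<close>
  let ?P = "\<lambda>f g :: 'a \<Rightarrow> real. g \<le> f"
  have "\<exists>m\<in>A. \<forall>q\<in>A. ?P m q \<longrightarrow> q = m"
  proof (rule predicate_Zorn)
    show "partial_order_on A (relation_of ?P A)"
      by (rule partial_order_on_relation_ofI) auto
  next
    fix C assume C: "C \<in> Chains (relation_of ?P A)"
    then have CA: "C \<subseteq> A" and total: "\<And>f g. f \<in> C \<Longrightarrow> g \<in> C \<Longrightarrow> f \<le> g \<or> g \<le> f"
      by (auto simp: Chains_def relation_of_def)
    show "\<exists>u\<in>A. \<forall>a\<in>C. u \<le> a"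
    proof (cases "C = {}")
      \<comment> \<open>An empty chain has no meaningful pointwise infimum, so \<open>p\<close>
        itself serves as its bound.\<close>
      case True
      then show ?thesis using p by (auto simp: A_def)
    next
      case False
      have bdd: "bdd_below ((\<lambda>f. f x) ` C)" for x
      proof (rule bdd_belowI2)
        fix f assume "f \<in> C"
        with CA have "sublinear f" "f (- x) \<le> p (- x)" by (auto simp: A_def)
        then show "- p (- x) \<le> f x" using sublinear_minus[of f x] by linarith
      qed
      let ?u = "\<lambda>x. INF f\<in>C. f x"
      have le: "?u x \<le> f x" if "f \<in> C" for f x
        using bdd that by (rule cINF_lower)
      have "sublinear ?u"
      proof (rule sublinear_INF[OF False bdd])
        fix f g x y assume fg: "f \<in> C" "g \<in> C"
        then have sub: "sublinear f" "sublinear g" using CA by (auto simp: A_def)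
        from total[OF fg] show "\<exists>k\<in>C. k (x + y) \<le> f x + g y"
        proof
          assume "f \<le> g"
          then show ?thesis
            using sublinear_add[OF sub(1), of x y] le_funD[of f g y] fg by (intro bexI[of _ f]) auto
        next
          assume "g \<le> f"
          then show ?thesis
            using sublinear_add[OF sub(2), of x y] le_funD[of g f x] fg by (intro bexI[of _ g]) auto
        qed
      next
        fix f x and r :: real assume "f \<in> C" "r > 0"
        then show "\<exists>k\<in>C. k (r *\<^sub>R x) \<le> r * f x"
          using CA sublinear_scaleR[of f r x] by (intro bexI[of _ f]) (auto simp: A_def)
      qed
      moreover have "?u x \<le> p x" for x
      proof -
        obtain f where "f \<in> C" using False by blast
        then show ?thesis using le[of f x] CA by (auto simp: A_def intro: order_trans)
      qed
      ultimately show ?thesis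
        by (intro bexI[of _ ?u]) (auto simp: A_def le_fun_def le)
    qed
  qed
  then obtain m where m: "m \<in> A" "\<And>q. q \<in> A \<Longrightarrow> q \<le> m \<Longrightarrow> q = m"
    by blast
  have "q = m" if "sublinear q" "\<And>x. q x \<le> m x" for q
  proof (rule m(2))
    show "q \<in> A" using that m(1) by (auto simp: A_def intro: order_trans)
    show "q \<le> m" using that by (simp add: le_fun_def)
  qed
  then show ?thesis using m(1) by (auto simp: A_def)
qed

lemma ex_norming_functional_real:
  fixes x0 :: "'a::real_normed_vector"
  shows "\<exists>u. linear u \<and> (\<forall>x. u x \<le> norm x) \<and> u x0 = norm x0"
proof -
  let ?q = "tilt norm x0"
  obtain u where u: "sublinear u" "\<And>x. u x \<le> ?q x"
    and minimal: "\<And>q. sublinear q \<Longrightarrow> (\<And>x. q x \<le> u x) \<Longrightarrow> q = u"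
    using ex_minimal_sublinear[OF sublinear_tilt[OF sublinear_norm, of x0]] by blast
  have lin: "linear u" using u(1) minimal by (rule minimal_sublinear_linear)
  have le: "u x \<le> norm x" for x
    using u(2)[of x] tilt_le_self[OF sublinear_norm, of x0 x] by linarith
  \<comment> \<open>At \<open>- x0\<close> the term \<open>t = 1\<close> of the infimum is
    \<open>norm 0 - norm x0\<close>; linearity of \<open>u\<close> turns this upper bound into a
    lower bound at \<open>x0\<close>.\<close>
  have "u (- x0) \<le> - norm x0"
    using u(2)[of "- x0"] tilt_le[OF sublinear_norm, of 1 x0 "- x0"] by simp
  then have "norm x0 \<le> u x0" by (simp add: linear_neg[OF lin])
  with le[of x0] have "u x0 = norm x0" by simp
  with lin le show ?thesis by blast
qed

section \<open>Real and complex scalars\<close>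

lemma to_complex_of_real [simp]:
  "to_complex (of_real r :: 'k::real_or_complex) = of_real r"
  by (simp add: of_real_def to_complex_scaleR to_complex_one)

lemma to_complex_zero [simp]: "to_complex (0 :: 'k::real_or_complex) = 0"
  using to_complex_of_real[of 0] by simp

lemma to_complex_diff:
  "to_complex (a - b :: 'k::real_or_complex) = to_complex a - to_complex b"
  using to_complex_add[of "a - b" b] by simp

text \<open>An additive isometry is injective. This transfers identities between complex numbers
  back to the scalars.\<close>

lemma to_complex_eqD: "to_complex a = to_complex b \<Longrightarrow> a = (b :: 'k::real_or_complex)"
  using norm_to_complex[of "a - b"] by (simp add: to_complex_diff)

lemma norm_add_mult_square:
  fixes a b c :: "'k::real_or_complex"
  shows "(norm (a + c * b))\<^sup>2 = (norm a)\<^sup>2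
    + 2 * Re (to_complex c * cnj (to_complex a) * to_complex b) + (norm c * norm b)\<^sup>2"
proof -
  have "(cmod (z + u * w))\<^sup>2
      = (cmod z)\<^sup>2 + 2 * Re (u * cnj z * w) + (cmod u * cmod w)\<^sup>2"
    for z u w
    unfolding power_mult_distrib cmod_power2 by (simp add: power2_eq_square algebra_simps)
  from this[of "to_complex a" "to_complex c" "to_complex b"] show ?thesis
    by (simp only: norm_to_complex flip: to_complex_add to_complex_mult)
qed

section \<open>The numerical radius\<close>

text \<open>Collecting the pairs in one set makes the numerical radius a supremum over an index set
  that does not depend on the operator. On the unit sphere the condition
  \<open>f x = of_real (norm x)\<close> becomes \<open>f x = 1\<close>.\<close>

definition numerical_pairs ::
    "('k::real_or_complex \<Rightarrow> 'a::real_normed_vector \<Rightarrow> 'a) \<Rightarrow> ('a \<times> ('a \<Rightarrow> 'k)) set" where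
  "numerical_pairs smul = {(x, f). norm x = 1 \<and> f \<in> dual_sphere smul \<and> f x = 1}"

lemma numerical_radius_alt:
  "numerical_radius smul T = (SUP (x, f)\<in>numerical_pairs smul. norm (f (T x)))"
  unfolding numerical_radius_def support_functionals_def numerical_pairs_def
  by (rule arg_cong[where f = Sup]) force

section \<open>Norming functionals that are linear over the scalar field\<close>

context normed_space_over
begin

lemma dual_spaceI:
  assumes "\<And>x y. f (x + y) = f x + f y" "\<And>c x. f (smul c x) = c * f x"
    and "\<And>x. norm (f x) \<le> norm x"
  shows "f \<in> dual_space smul"
proof -
  have "vector_space ((*) :: 'k \<Rightarrow> _)"
    by unfold_locales (simp_all add: algebra_simps)
  then have "Vector_Spaces.linear smul (*) f"
    using assms(1,2) vector_space_axioms
    by (simp add: module_hom_def module_hom_axioms_def module_iff_vector_space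
        flip: module_hom_iff_linear)
  moreover have "bounded_linear f"
  proof (rule bounded_linear_intro)
    fix r x show "f (r *\<^sub>R x) = r *\<^sub>R f x"
      using assms(2)[of "of_real r" x] by (simp add: scale_of_real scaleR_conv_of_real)
  next
    fix x show "norm (f x) \<le> norm x * 1" using assms(3) by simp
  qed (rule assms(1))
  ultimately show ?thesis by (simp add: dual_space_def)
qed

lemma dual_space_add: "f \<in> dual_space smul \<Longrightarrow> f (x + y) = f x + f y"
  by (simp add: dual_space_def bounded_linear.linear linear_add)

lemma dual_space_smul: "f \<in> dual_space smul \<Longrightarrow> f (smul c x) = c * f x"
  by (auto simp: dual_space_def Vector_Spaces.linear_def module_hom_def module_hom_axioms_def)

lemma dual_sphere_le:
  assumes "f \<in> dual_sphere smul"
  shows "norm (f x) \<le> norm x"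
  using onorm[of f x] assms by (simp add: dual_sphere_def dual_space_def)

text \<open>A functional linear over the scalars is determined by its real part, so the real norming
  functional \<open>u\<close> is extended to an \<open>f\<close> with real part \<open>u\<close>.
  The norm bound survives the extension.\<close>

lemma ex_norming_functional:
  "\<exists>f\<in>dual_space smul. (\<forall>x. norm (f x) \<le> norm x) \<and> f x0 = of_real (norm x0)"
proof -
  obtain u where u: "linear u" "\<And>x. u x \<le> norm x" "u x0 = norm x0"
    using ex_norming_functional_real by blast
  note u_simps = linear_add[OF u(1)] linear_diff[OF u(1)] linear_scale[OF u(1)]
  have "\<exists>f :: 'a \<Rightarrow> 'k. (\<forall>x y. f (x + y) = f x + f y) \<and> (\<forall>c x. f (smul c x) = c * f x)
      \<and> (\<forall>x. Re (to_complex (f x)) = u x)"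
    using range_to_complex[where 'a='k]
  proof
    assume *: "range (to_complex :: 'k \<Rightarrow> complex) = \<real>"
    \<comment> \<open>Here every scalar is real, so real linearity of \<open>u\<close> already is
      linearity over the scalars.\<close>
    have of_real: "\<exists>r. c = of_real r" for c :: 'k
    proof -
      have "to_complex c \<in> \<real>" using * by blast
      then obtain r where "to_complex c = of_real r" by (auto elim: Reals_cases)
      then have "c = of_real r" by (simp add: to_complex_eqD)
      then show ?thesis ..
    qed
    have "of_real (u (smul c x)) = c * of_real (u x)" for c x
      using of_real[of c] by (auto simp: scale_of_real u_simps)
    then show ?thesis
      by (intro exI[of _ "\<lambda>x. of_real (u x)"]) (simp add: u_simps)
  next
    assume *: "range (to_complex :: 'k \<Rightarrow> complex) = UNIV"
    then obtain i :: 'k where i: "to_complex i = \<i>" by (metis surjD)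
    have ii: "i * i = - 1"
      by (rule to_complex_eqD)
        (use to_complex_diff[of 0 "1 :: 'k"] in \<open>simp add: i to_complex_mult to_complex_one\<close>)
    \<comment> \<open>Linearity forces this formula: the real part of \<open>f (smul i x)\<close> is
      \<open>u (smul i x)\<close>, and it has to be minus the imaginary part of
      \<open>f x\<close>.\<close>
    let ?f = "\<lambda>x. of_real (u x) - i * of_real (u (smul i x))"
    have "?f (smul c x) = c * ?f x" for c x
    proof -
      obtain a b where c: "c = of_real a + i * of_real b"
      proof
        show "c = of_real (Re (to_complex c)) + i * of_real (Im (to_complex c))"
          by (rule to_complex_eqD) (simp add: to_complex_add to_complex_mult i flip: complex_eq)
      qed
      have "smul c x = a *\<^sub>R x + b *\<^sub>R smul i x"
        unfolding c by (simp add: scale_left_distrib mult.commute[of i] flip: scale_of_real)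
      moreover have "smul i (smul c x) = a *\<^sub>R smul i x - b *\<^sub>R x"
      proof -
        have "i * c = of_real a * i - of_real b"
          using ii by (simp add: c algebra_simps flip: mult.assoc)
        then show ?thesis
          by (simp add: scale_left_diff_distrib flip: scale_of_real)
      qed
      ultimately have "?f (smul c x)
          = of_real (a * u x + b * u (smul i x)) - i * of_real (a * u (smul i x) - b * u x)"
        by (simp add: u_simps)
      \<comment> \<open>The multiple of \<open>i * i + 1\<close> is kept explicit so that the
        equation is a polynomial identity, valid before \<open>ii\<close> is applied.\<close>
      also have "\<dots> = c * ?f x - (i * i + 1) * of_real (- b * u (smul i x))"
        unfolding c by (simp add: algebra_simps)
      finally show ?thesis by (simp add: ii)
    qed
    moreover have "Re (to_complex (?f x)) = u x" for x
      by (simp add: to_complex_diff to_complex_mult i)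
    ultimately show ?thesis
      by (intro exI[of _ ?f]) (simp add: u_simps scale_right_distrib algebra_simps)
  qed
  then obtain f :: "'a \<Rightarrow> 'k" where f: "\<And>x y. f (x + y) = f x + f y"
    "\<And>c x. f (smul c x) = c * f x" "\<And>x. Re (to_complex (f x)) = u x"
    by blast
  \<comment> \<open>Rotating \<open>x\<close> by a unimodular scalar makes \<open>f x\<close> real, where it agrees with \<open>u\<close>.\<close>
  have le: "norm (f x) \<le> norm x" for x
  proof (cases "f x = 0")
    case False
    define c where "c = of_real (norm (f x)) / f x"
    have "f (smul c x) = of_real (norm (f x))" using False by (simp add: f(2) c_def)
    then have "norm (f x) = u (smul c x)" using f(3)[of "smul c x"] by simp
    also have "\<dots> \<le> norm (smul c x)" by (rule u(2))
    also have "\<dots> = norm x" using False by (simp add: norm_scale c_def norm_divide)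
    finally show ?thesis .
  qed simp
  have "f x0 = of_real (norm x0)"
  proof -
    let ?z = "to_complex (f x0)"
    \<comment> \<open>The real part of \<open>f x0\<close> is already \<open>norm x0\<close>, the
      largest modulus allowed, so no imaginary part is left.\<close>
    have "cmod ?z \<le> Re ?z" using le[of x0] by (simp add: norm_to_complex f(3) u(3))
    then have "(cmod ?z)\<^sup>2 \<le> (Re ?z)\<^sup>2" by (simp add: power_mono)
    then have "Im ?z = 0" unfolding cmod_power2 by simp
    then have "?z = of_real (norm x0)" by (simp add: complex_eq_iff f(3) u(3))
    then show ?thesis by (simp add: to_complex_eqD)
  qed
  with le dual_spaceI[OF f(1,2) le] show ?thesis by blast
qed

lemma dual_sphereI:
  assumes "f \<in> dual_space smul" "\<And>y. norm (f y) \<le> norm y" "norm (f x) = 1" "norm x = 1"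
  shows "f \<in> dual_sphere smul"
proof -
  have "onorm f \<le> 1" by (rule onorm_bound) (simp_all add: assms(2))
  moreover have "1 \<le> onorm f"
    using onorm[of f x] assms by (simp add: dual_space_def)
  ultimately show ?thesis using assms(1) by (simp add: dual_sphere_def)
qed

text \<open>Near-maximizing pairs can be chosen only if the supremum is over a nonempty set; here
  the existence of norming functionals enters.\<close>

lemma numerical_pairs_nonempty:
  assumes "(y :: 'a) \<noteq> 0"
  shows "numerical_pairs smul \<noteq> {}"
proof -
  let ?x = "y /\<^sub>R norm y"
  have x: "norm ?x = 1" using assms by simp
  obtain f where f: "f \<in> dual_space smul" "\<And>z. norm (f z) \<le> norm z" "f ?x = of_real (norm ?x)"
    using ex_norming_functional[of ?x] by blast
  with x have "f ?x = 1" by simp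
  with x f have "(?x, f) \<in> numerical_pairs smul"
    by (auto simp: numerical_pairs_def intro!: dual_sphereI[of f ?x])
  then show ?thesis by blast
qed

text \<open>In the zero space the empty set is a basis, and its cardinality 0 is below
  \<open>n\<close>.\<close>

lemma nonzero_if_dimension_at_least:
  assumes "dimension_at_least smul n" "n > 0"
  shows "\<exists>y :: 'a. y \<noteq> 0"
proof (rule ccontr)
  assume "\<nexists>y :: 'a. y \<noteq> 0"
  then have "span {} = UNIV" by (metis UNIV_eq_I span_zero)
  then show False using assms independent_empty by (force simp: dimension_at_least_def)
qed

section \<open>Values on numerical pairs and their supremum\<close>

lemma numerical_pair_le:
  assumes "(x, f) \<in> numerical_pairs smul" "bounded_linear A"
  shows "norm (f (A x)) \<le> onorm A"
  using assms dual_sphere_le[of f "A x"] onorm[of A x] by (auto simp: numerical_pairs_def)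

lemma numerical_radius_bdd_above:
  assumes "bounded_linear A"
  shows "bdd_above ((\<lambda>(x, f). norm (f (A x))) ` numerical_pairs smul)"
  using numerical_pair_le[OF _ assms] by (intro bdd_aboveI2[of _ _ "onorm A"]) auto

lemma numerical_radius_ge:
  assumes "(x, f) \<in> numerical_pairs smul" "bounded_linear A"
  shows "norm (f (A x)) \<le> numerical_radius smul A"
  using cSUP_upper[OF assms(1) numerical_radius_bdd_above[OF assms(2)]]
  by (simp add: numerical_radius_alt)

lemma less_numerical_radiusD:
  assumes "r < numerical_radius smul A" "bounded_linear A" "numerical_pairs smul \<noteq> {}"
  shows "\<exists>x f. (x, f) \<in> numerical_pairs smul \<and> r < norm (f (A x))"
  using assms less_cSUP_iff[OF assms(3) numerical_radius_bdd_above[OF assms(2)]]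
  by (auto simp: numerical_radius_alt)

section \<open>The operators \<open>T + c S\<close> and the two implications\<close>

lemma bounded_linear_smul: "bounded_linear (smul c)"
proof (rule bounded_linear_intro)
  show "smul c (r *\<^sub>R x) = r *\<^sub>R smul c x" for r x
    by (simp add: mult.commute flip: scale_of_real)
  show "norm (smul c x) \<le> norm x * norm c" for x
    by (simp add: norm_scale mult.commute)
qed (rule scale_right_distrib)

lemma bounded_linear_pencil:
  "bounded_linear T \<Longrightarrow> bounded_linear S \<Longrightarrow> bounded_linear (\<lambda>x. T x + smul c (S x))"
  by (intro bounded_linear_add bounded_linear_compose[OF bounded_linear_smul])

lemma numerical_pair_pencil:
  "(x, f) \<in> numerical_pairs smul \<Longrightarrow> f (T x + smul c (S x)) = f (T x) + c * f (S x)"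
  by (simp add: numerical_pairs_def dual_sphere_def dual_space_add dual_space_smul)

text \<open>Dropping the nonnegative last term of \<open>norm_add_mult_square\<close> leaves a bound
  by \<open>?w\<^sup>2\<close> for each \<open>n\<close>. In the limit it becomes
  \<open>?v\<^sup>2 + 2 * t * L \<le> ?w\<^sup>2\<close>, where \<open>t * L\<close> is
  nonnegative.\<close>

lemma numerical_radius_le_pencil:
  fixes T S :: "'a \<Rightarrow> 'a" and x :: "nat \<Rightarrow> 'a" and f :: "nat \<Rightarrow> 'a \<Rightarrow> 'k"
  assumes T: "bounded_linear T" and S: "bounded_linear S" and "t \<ge> 0"
    and pairs: "\<And>n. (x n, f n) \<in> numerical_pairs smul"
    and limT: "(\<lambda>n. norm (f n (T (x n)))) \<longlonglongrightarrow> numerical_radius smul T"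
    and limRe: "(\<lambda>n. Re (to_complex l * cnj (to_complex (f n (T (x n))))
      * to_complex (f n (S (x n))))) \<longlonglongrightarrow> L" and "L \<ge> 0"
  shows "numerical_radius smul T \<le> numerical_radius smul (\<lambda>x. T x + smul (of_real t * l) (S x))"
    (is "?v \<le> ?w")
proof -
  let ?R = "\<lambda>n. Re (to_complex l * cnj (to_complex (f n (T (x n)))) * to_complex (f n (S (x n))))"
  have norm_le: "norm (f n (T (x n)) + of_real t * l * f n (S (x n))) \<le> ?w" for n
    using numerical_radius_ge[OF pairs bounded_linear_pencil[OF T S]]
    by (simp add: numerical_pair_pencil[OF pairs])
  have "(norm (f n (T (x n))))\<^sup>2 + 2 * t * ?R n \<le> ?w\<^sup>2" for n
  proof -
    have "(norm (f n (T (x n))))\<^sup>2 + 2 * t * ?R n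
        \<le> (norm (f n (T (x n)) + of_real t * l * f n (S (x n))))\<^sup>2"
      unfolding norm_add_mult_square by (simp add: to_complex_mult mult.assoc)
    also have "\<dots> \<le> ?w\<^sup>2" using norm_le by (simp add: power_mono)
    finally show ?thesis .
  qed
  moreover have "(\<lambda>n. (norm (f n (T (x n))))\<^sup>2 + 2 * t * ?R n) \<longlonglongrightarrow> ?v\<^sup>2 + 2 * t * L"
    by (intro tendsto_intros limT limRe)
  ultimately have "?v\<^sup>2 + 2 * t * L \<le> ?w\<^sup>2"
    by (intro LIMSEQ_le_const2) auto
  then have "?v\<^sup>2 \<le> ?w\<^sup>2"
    using mult_nonneg_nonneg[OF \<open>t \<ge> 0\<close> \<open>L \<ge> 0\<close>] by simp
  moreover have "0 \<le> ?w" using order_trans[OF norm_ge_zero norm_le] .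
  ultimately show ?thesis by (rule power2_le_imp_le)
qed

text \<open>The pair is chosen within \<open>e\<^sup>2\<close> of the supremum, not merely within
  \<open>e\<close>, because the estimate for the real part is divided by \<open>2 * e\<close> at the
  end and its error must still vanish with \<open>e\<close>. Dividing
  \<open>2 * ?v * e\<^sup>2 + e\<^sup>2 * ?K\<^sup>2\<close> by \<open>2 * e\<close> gives the
  constant of the last conjunct.\<close>

lemma near_maximizing_pair:
  fixes T S :: "'a \<Rightarrow> 'a" and l :: 'k
  assumes T: "bounded_linear T" and S: "bounded_linear S" and l: "norm l = 1" and e: "e > 0"
    and ne: "numerical_pairs smul \<noteq> {}"
    and le: "numerical_radius smul T \<le> numerical_radius smul (\<lambda>x. T x + smul (of_real e * l) (S x))"
  shows "\<exists>x f. (x, f) \<in> numerical_pairs smul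
    \<and> numerical_radius smul T - e * (e + onorm S) \<le> norm (f (T x))
    \<and> - (e * (numerical_radius smul T + (onorm S)\<^sup>2 / 2))
      \<le> Re (to_complex l * cnj (to_complex (f (T x))) * to_complex (f (S x)))"
proof -
  let ?v = "numerical_radius smul T" and ?c = "of_real e * l :: 'k" and ?K = "onorm S"
  have "?v - e\<^sup>2 < numerical_radius smul (\<lambda>x. T x + smul ?c (S x))"
    using le e by (smt (verit) zero_less_power2)
  then obtain x f where xf: "(x, f) \<in> numerical_pairs smul"
    and "?v - e\<^sup>2 < norm (f (T x + smul ?c (S x)))"
    using less_numerical_radiusD[OF _ bounded_linear_pencil[OF T S] ne] by blast
  then have gt: "?v - e\<^sup>2 < norm (f (T x) + ?c * f (S x))" (is "_ < ?w")
    by (simp add: numerical_pair_pencil)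
  let ?R = "Re (to_complex l * cnj (to_complex (f (T x))) * to_complex (f (S x)))"
  have Sx: "norm (f (S x)) \<le> ?K" using numerical_pair_le[OF xf S] .
  have Tx: "norm (f (T x)) \<le> ?v" using numerical_radius_ge[OF xf T] .
  have norm_c: "norm (?c * f (S x)) = e * norm (f (S x))" using e l by (simp add: norm_mult)
  have "?w \<le> norm (f (T x)) + e * norm (f (S x))"
    using norm_triangle_ineq[of "f (T x)" "?c * f (S x)"] by (simp add: norm_c)
  also have "\<dots> \<le> norm (f (T x)) + e * ?K" using Sx e by simp
  finally have 1: "?v - e * (e + ?K) \<le> norm (f (T x))"
    using gt by (simp add: power2_eq_square algebra_simps)
  have v0: "0 \<le> ?v" using order_trans[OF norm_ge_zero Tx] .
  \<comment> \<open>Squaring \<open>?v - e\<^sup>2 < ?w\<close> requires a nonnegative left-hand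
    side. If \<open>?v < e\<^sup>2\<close>, the claimed lower bound is itself nonpositive.\<close>
  have "?v\<^sup>2 - 2 * ?v * e\<^sup>2 \<le> ?w\<^sup>2"
  proof (cases "?v \<ge> e\<^sup>2")
    case True
    then have "(?v - e\<^sup>2)\<^sup>2 \<le> ?w\<^sup>2" using gt by (intro power_mono) auto
    moreover have "(?v - e\<^sup>2)\<^sup>2 = ?v\<^sup>2 - 2 * ?v * e\<^sup>2 + (e\<^sup>2)\<^sup>2" by (simp add: power2_diff)
    ultimately show ?thesis using zero_le_power2[of "e\<^sup>2"] by linarith
  next
    case False
    then have "?v * (?v - 2 * e\<^sup>2) \<le> 0"
      using v0 by (intro mult_nonneg_nonpos) auto
    then have "?v\<^sup>2 - 2 * ?v * e\<^sup>2 \<le> 0" by (simp add: power2_eq_square algebra_simps)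
    then show ?thesis using zero_le_power2[of ?w] by linarith
  qed
  also have "?w\<^sup>2 = (norm (f (T x)))\<^sup>2 + 2 * e * ?R + e\<^sup>2 * (norm (f (S x)))\<^sup>2"
    unfolding norm_add_mult_square using e l
    by (simp add: to_complex_mult norm_mult power_mult_distrib mult.assoc)
  also have "\<dots> \<le> ?v\<^sup>2 + 2 * e * ?R + e\<^sup>2 * ?K\<^sup>2"
    using Sx Tx e by (intro add_mono mult_left_mono power_mono) auto
  finally have "2 * e * (- (e * (?v + ?K\<^sup>2 / 2))) \<le> 2 * e * ?R"
    by (simp add: power2_eq_square algebra_simps)
  then have "- (e * (?v + ?K\<^sup>2 / 2)) \<le> ?R" by (rule mult_left_le_imp_le) (use e in simp)
  with xf 1 show ?thesis by blast
qed

text \<open>Pairs for \<open>e = 1 / (n + 1)\<close> make the first limit exist, but for the real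
  parts they only give a lower bound tending to 0. These are bounded, so a subsequence along which
  they converge is taken, and it keeps the first limit.\<close>

lemma ex_maximizing_sequence:
  fixes T S :: "'a \<Rightarrow> 'a" and l :: 'k
  assumes T: "bounded_linear T" and S: "bounded_linear S" and l: "norm l = 1"
    and ne: "numerical_pairs smul \<noteq> {}"
    and orth: "numerical_radius_orthogonal smul T S"
  shows "\<exists>x f L. (\<forall>n. (x n, f n) \<in> numerical_pairs smul)
    \<and> (\<lambda>n. norm (f n (T (x n)))) \<longlonglongrightarrow> numerical_radius smul T \<and> L \<ge> 0
    \<and> (\<lambda>n. Re (to_complex l * cnj (to_complex (f n (T (x n))))
        * to_complex (f n (S (x n))))) \<longlonglongrightarrow> L"
proof -
  let ?v = "numerical_radius smul T" and ?K = "onorm S"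
  define e :: "nat \<Rightarrow> real" where "e n = inverse (real (Suc n))" for n
  have e: "e n > 0" for n by (simp add: e_def)
  have e_lim: "e \<longlonglongrightarrow> 0" unfolding e_def by (rule LIMSEQ_inverse_real_of_nat)
  have "\<forall>n. \<exists>x f. (x, f) \<in> numerical_pairs smul
    \<and> ?v - e n * (e n + ?K) \<le> norm (f (T x))
    \<and> - (e n * (?v + ?K\<^sup>2 / 2))
      \<le> Re (to_complex l * cnj (to_complex (f (T x))) * to_complex (f (S x)))"
    using orth by (intro allI near_maximizing_pair[OF T S l e ne])
      (simp add: numerical_radius_orthogonal_def)
  then obtain x f where pairs: "\<And>n. (x n, f n) \<in> numerical_pairs smul"
    and lower: "\<And>n. ?v - e n * (e n + ?K) \<le> norm (f n (T (x n)))"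
    and Re_lower: "\<And>n. - (e n * (?v + ?K\<^sup>2 / 2))
      \<le> Re (to_complex l * cnj (to_complex (f n (T (x n)))) * to_complex (f n (S (x n))))"
      (is "\<And>n. _ \<le> ?R n")
    by metis
  have limT: "(\<lambda>n. norm (f n (T (x n)))) \<longlonglongrightarrow> ?v"
  proof (rule tendsto_sandwich[OF _ _ _ tendsto_const])
    have "(\<lambda>n. ?v - e n * (e n + ?K)) \<longlonglongrightarrow> ?v - 0 * (0 + ?K)"
      by (intro tendsto_intros e_lim)
    then show "(\<lambda>n. ?v - e n * (e n + ?K)) \<longlonglongrightarrow> ?v" by simp
  qed (use lower numerical_radius_ge[OF pairs T] in auto)
  have "norm (?R n) \<le> ?v * ?K" for n
  proof -
    have "norm (?R n) \<le> norm (f n (T (x n))) * norm (f n (S (x n)))"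
      using abs_Re_le_cmod[of "to_complex l * cnj (to_complex (f n (T (x n))))
        * to_complex (f n (S (x n)))"] l
      by (simp add: norm_mult norm_to_complex)
    also have "\<dots> \<le> ?v * ?K"
      using numerical_radius_ge[OF pairs T, of n] numerical_pair_le[OF pairs S, of n]
      by (intro mult_mono) (auto intro: order_trans[OF norm_ge_zero])
    finally show ?thesis .
  qed
  then have "bounded (range ?R)" by (auto simp: bounded_iff)
  then obtain L s where s: "strict_mono s" and L: "(?R \<circ> s) \<longlonglongrightarrow> L"
    using bounded_imp_convergent_subsequence by blast
  have "(\<lambda>n. - (e (s n) * (?v + ?K\<^sup>2 / 2))) \<longlonglongrightarrow> - (0 * (?v + ?K\<^sup>2 / 2))"
    using LIMSEQ_subseq_LIMSEQ[OF e_lim s] by (intro tendsto_intros) (simp add: o_def)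
  \<comment> \<open>The lower bounds still tend to 0 along the subsequence, so \<open>L\<close> is
    nonnegative.\<close>
  then have "L \<ge> - (0 * (?v + ?K\<^sup>2 / 2))"
    using L Re_lower by (intro LIMSEQ_le) auto
  then show ?thesis
    using pairs L LIMSEQ_subseq_LIMSEQ[OF limT s]
    by (intro exI[of _ "x \<circ> s"] exI[of _ "f \<circ> s"] exI[of _ L]) (simp add: o_def)
qed

end

theorem theorem24:
  fixes smul :: "'k::real_or_complex \<Rightarrow> 'a::real_normed_vector \<Rightarrow> 'a"
    and T S :: "'a \<Rightarrow> 'a"
  assumes "normed_space_over smul"
    and "dimension_at_least smul 2"
    and "T \<in> bounded_operators smul"
    and "S \<in> bounded_operators smul"
  shows "numerical_radius_orthogonal smul T S \<longleftrightarrow>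
    (\<forall>l::'k. norm l = 1 \<longrightarrow>
      (\<exists>(x :: nat \<Rightarrow> 'a) (f :: nat \<Rightarrow> 'a \<Rightarrow> 'k).
        (\<forall>n. x n \<in> sphere 0 1 \<and> f n \<in> dual_sphere smul \<and> f n (x n) = 1) \<and>
        (\<lambda>n. norm (f n (T (x n)))) \<longlonglongrightarrow> numerical_radius smul T \<and>
        (\<exists>L\<ge>0. (\<lambda>n. Re (to_complex l * cnj (to_complex (f n (T (x n)))) *
                          to_complex (f n (S (x n))))) \<longlonglongrightarrow> L)))"
    (is "_ \<longleftrightarrow> (\<forall>l. norm l = 1 \<longrightarrow> ?seq l)")
proof -
  interpret normed_space_over smul by fact
  have T: "bounded_linear T" and S: "bounded_linear S"
    using assms(3,4) by (simp_all add: bounded_operators_def)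
  have ne: "numerical_pairs smul \<noteq> {}"
    using nonzero_if_dimension_at_least[OF assms(2)] numerical_pairs_nonempty by auto
  have pair_iff: "x \<in> sphere 0 1 \<and> f \<in> dual_sphere smul \<and> f x = 1
      \<longleftrightarrow> (x, f) \<in> numerical_pairs smul" for x f
    by (simp add: numerical_pairs_def)
  show ?thesis
    unfolding pair_iff
  proof (intro iffI allI impI, goal_cases)
    case (1 l)
    then show ?case using ex_maximizing_sequence[OF T S _ ne] by blast
  next
    case 2
    show ?case
      unfolding numerical_radius_orthogonal_def
    proof
      fix \<alpha> :: 'k
      \<comment> \<open>Polar form of the scalar: its direction \<open>l\<close> selects the
        sequences and its modulus plays the part of \<open>t\<close>. For
        \<open>\<alpha> = 0\<close> any unimodular \<open>l\<close> will do, and 1 is taken.\<close>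
      obtain l where l: "norm l = 1" "\<alpha> = of_real (norm \<alpha>) * l"
      proof (cases "\<alpha> = 0")
        case False
        then show ?thesis using that[of "\<alpha> / of_real (norm \<alpha>)"] by (simp add: norm_divide)
      qed (use that[of 1] in simp)
      with 2 obtain x f L where "\<And>n. (x n, f n) \<in> numerical_pairs smul"
        "(\<lambda>n. norm (f n (T (x n)))) \<longlonglongrightarrow> numerical_radius smul T" "L \<ge> 0"
        "(\<lambda>n. Re (to_complex l * cnj (to_complex (f n (T (x n))))
          * to_complex (f n (S (x n))))) \<longlonglongrightarrow> L"
        by blast
      then have "numerical_radius smul T
          \<le> numerical_radius smul (\<lambda>x. T x + smul (of_real (norm \<alpha>) * l) (S x))"
        by (intro numerical_radius_le_pencil[OF T S]) auto
      then show "numerical_radius smul T \<le> numerical_radius smul (\<lambda>x. T x + smul \<alpha> (S x))"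
        by (simp flip: l(2))
    qed
  qed
qed

end
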